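(* Consider a smooth pure exchange economy with $m$ consumers and $l$ goods, equilibrium manifold $E\subset S\times\Omega$, natural projection $\pi\colon E\to\Omega$ and set of crisis transitions $\mathcal B\subset E$ (all as defined in the context). Let $e_*\in E$ be an equilibrium such that $\dim\operatorname{Ker}D\pi(e_* )$ is odd and, for some $v\in T_{e_*}(E)$, the second intrinsic derivative $\partial^2_v\pi(e_* )$ is an isomorphism. Let $U$ be a neighbourhood of $e_*$ in $E$ and let $e_\pm=(p_\pm,\omega_\pm)\in U$ be regular equilibria belonging to different path components of $E\setminus\mathcal B$ and such that $\omega_\pm$ are regular economies. Let $W(\omega_+)=\{p\in S: (p,\omega_+)\in E\}$ and $d=\operatorname{dist}\big(p_+,\,W(\omega_+)\setminus\{p_+\}\big)$ (with $d=+\infty$ if this set is empty). Then any path $\gamma$ in $\Omega$ from $\omega_-$ to $\omega_+$ either intersects the set $\pi(\mathcal B)$ of crisis economies, or the unique lifting of $\gamma$ to $E$ with initial point $e_-=(p_-,\omega_-)$ has an endpoint $e=(p,\omega_+)$ with $\|p-p_+\|\ge d$.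
   Context: Economy. $X=\mathbb R^l_{++}$ is the strictly positive orthant; $S=\{(p_1,\dots,p_l)\in\mathbb R^l_{++} : p_l=1\}$ is the set of normalized prices, identified with an open subset of $\mathbb R^{l-1}$. Each consumer $i=1,\dots,m$ has a fixed smooth utility function $u_i\colon X\to\mathbb R$ such that: (monotonicity) $\nabla u_i(x)\in\mathbb R^l_{++}$ for every $x\in X$; (strict quasi-concavity) the Hessian $D^2u_i(x)$ is negative definite on the tangent hyperplane at $x$ to the indifference surface through $x$; (necessity) for every $r\in\mathbb R$ the indifference surface $\{x\in X: u_i(x)=r\}$ is closed in $\mathbb R^l$. For an endowment $\omega_i\in X$ and $p\in S$, the demand $x_i(p,\omega_i)\in X$ is the unique maximizer of $u_i$ on $\{x\in X: p\cdot x\le p\cdot\omega_i\}$; it satisfies $p\cdot x_i(p,\omega_i)=p\cdot\omega_i$ and depends smoothly on $(p,\omega_i)$. An economy is $\omega=(\omega_1,\dots,\omega_m)\in\Omega=\mathbb R^{ml}_{++}$. The excess demand is $z\colon S\times\Omega\to\mathbb R^l$, $z(p,\omega)=\sum_{i=1}^m(x_i(p,\omega_i)-\omega_i)$. An equilibrium is a pair $(p,\omega)\in S\times\Omega$ with $z(p,\omega)=0$. The equilibrium manifold $E=\{(p,\omega): z(p,\omega)=0\}$ is a smooth $ml$-dimensional submanifold of $S\times\Omega$, diffeomorphic to Euclidean space; the natural projection $\pi\colon E\to\Omega$, $\pi(p,\omega)=\omega$, is smooth and proper. A regular equilibrium is a point $e\in E$ at which $D\pi(e)$ is an isomorphism;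 a regular economy is a regular value $\omega\in\Omega$ of $\pi$. A crisis transition (crisis) is a point $e_*=(p_*,\omega_* )\in E$ such that on no neighbourhood of $\omega_*$ does there exist a continuous selection $\omega\mapsto p(\omega)$ of equilibrium prices with $p(\omega_* )=p_*$; equivalently, $\pi$ is not a local homeomorphism at $e_*$. $\mathcal B\subset E$ denotes the set of crisis transitions. Intrinsic derivative. Let $\psi\colon F\to F'$ be a morphism of smooth vector bundles over a manifold $M$, $x\in M$, $v\in T_x(M)$. Choose trivializations of $F,F'$ over a neighbourhood of $x$ with fibres $F_x,F'_x$, equal to the identity at $x$; in them $\psi$ becomes a smooth map $L$ into $\operatorname{Hom}(F_x,F'_x)$ with $L(x)=\psi_x$. With $l(t)=L(\exp(tv))$, where $\exp$ is any exponential map at $x$, the intrinsic derivative is $\partial_v\psi(x)=k\,\dot l(0)\,i\colon\operatorname{Ker}\psi_x\to\operatorname{Coker}\psi_x$, where $i$ is the inclusion of the kernel and $k$ the projection to the cokernel. It is independent of the choices. For a smooth map $f\colon M\to N$ regard $Df$ as a bundle morphism $T(M)\to f^*T(N)$; then $\partial_v^2f(x)=\partial_v(Df)(x)\colon\operatorname{Ker}Df(x)\to\operatorname{Coker}Df(x)$. *)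

theory Defs
  imports "HOL-Analysis.Analysis" "HOL-Library.Set_Algebras"
begin

section \<open>Smooth maps and submanifolds of Euclidean spaces\<close>

text \<open>
  \<open>Ck_on k U f\<close> is meant for open \<open>U\<close>.  In finite dimensions all directional derivatives of a
  differentiable map being of class \<open>C\<^sup>k\<close> is the same as the derivative being of class \<open>C\<^sup>k\<close>.
\<close>

primrec Ck_on ::
  "nat \<Rightarrow> 'a::euclidean_space set \<Rightarrow> ('a \<Rightarrow> 'b::euclidean_space) \<Rightarrow> bool" where
  "Ck_on 0 U f \<longleftrightarrow> continuous_on U f"
| "Ck_on (Suc k) U f \<longleftrightarrow>
     (\<forall>x\<in>U. f differentiable (at x)) \<and> (\<forall>v. Ck_on k U (\<lambda>x. frechet_derivative f (at x) v))"

definition smooth_open :: "'a::euclidean_space set \<Rightarrow> ('a \<Rightarrow> 'b::euclidean_space) \<Rightarrow> bool" where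
  "smooth_open U f \<longleftrightarrow> open U \<and> (\<forall>k. Ck_on k U f)"

text \<open>Smoothness on an arbitrary subset: locally the restriction of a smooth map on an open set.\<close>

definition smooth_on :: "'a::euclidean_space set \<Rightarrow> ('a \<Rightarrow> 'b::euclidean_space) \<Rightarrow> bool" where
  "smooth_on A f \<longleftrightarrow> (\<forall>x\<in>A. \<exists>U g. x \<in> U \<and> smooth_open U g \<and> (\<forall>y\<in>A \<inter> U. g y = f y))"

text \<open>
  Throughout, a manifold is a smooth submanifold \<open>M\<close> of a Euclidean space, given by its underlying
  set.  Tangent vectors are velocities of smooth curves in \<open>M\<close>.
\<close>

definition curve_at :: "'a::euclidean_space set \<Rightarrow> 'a \<Rightarrow> 'a \<Rightarrow> (real \<Rightarrow> 'a) \<Rightarrow> bool" where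
  "curve_at M x v c \<longleftrightarrow>
     (\<exists>\<delta>>0. smooth_open {-\<delta><..<\<delta>} c \<and> c ` {-\<delta><..<\<delta>} \<subseteq> M) \<and>
     c 0 = x \<and> (c has_vector_derivative v) (at 0)"

definition tangent_space :: "'a::euclidean_space set \<Rightarrow> 'a \<Rightarrow> 'a set" where
  "tangent_space M x = {v. \<exists>c. curve_at M x v c}"

text \<open>The differential \<open>Df(x)\<close> of a smooth map \<open>f\<close> on \<open>M\<close>, meaningful on \<open>tangent_space M x\<close>.\<close>

definition differential ::
  "'a::euclidean_space set \<Rightarrow> ('a \<Rightarrow> 'b::euclidean_space) \<Rightarrow> 'a \<Rightarrow> 'a \<Rightarrow> 'b" where
  "differential M f x v =
     (THE w. \<exists>c. curve_at M x v c \<and> ((f \<circ> c) has_vector_derivative w) (at 0))"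


section \<open>The intrinsic derivative of a bundle morphism\<close>

text \<open>
  A vector bundle over \<open>M\<close> is a family \<open>F\<close> of linear subspaces of a fixed Euclidean space, that
  is, a subbundle of a trivial bundle.  The map \<open>\<tau> y\<close> matters only on \<open>F x\<close>; requiring it to be
  linear everywhere is no restriction, since one may precompose with a projection onto \<open>F x\<close>.
\<close>

definition trivialization_at ::
  "'a::euclidean_space set \<Rightarrow> ('a \<Rightarrow> 'b::euclidean_space set) \<Rightarrow> 'a \<Rightarrow> ('a \<Rightarrow> 'b \<Rightarrow> 'b) \<Rightarrow> bool" where
  "trivialization_at M F x \<tau> \<longleftrightarrow>
     (\<exists>V. open V \<and> x \<in> V \<and>
        smooth_on ((M \<inter> V) \<times> F x) (\<lambda>(y, w). \<tau> y w) \<and>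
        (\<forall>y\<in>M \<inter> V. linear (\<tau> y) \<and> bij_betw (\<tau> y) (F x) (F y))) \<and>
     (\<forall>w\<in>F x. \<tau> x w = w)"

text \<open>
  Exponential maps at \<open>x\<close>, defined near \<open>0\<close> in the tangent space.  Of such a map only the property
  that it is smooth with value \<open>x\<close> and derivative the identity at \<open>0\<close> is required; the intrinsic
  derivative depends on nothing else.
\<close>

definition exponential_at :: "'a::euclidean_space set \<Rightarrow> 'a \<Rightarrow> ('a \<Rightarrow> 'a) \<Rightarrow> bool" where
  "exponential_at M x ex \<longleftrightarrow>
     (\<exists>N. open N \<and> 0 \<in> N \<and> smooth_on (tangent_space M x \<inter> N) ex \<and>
          ex ` (tangent_space M x \<inter> N) \<subseteq> M) \<and>
     ex 0 = x \<and>
     (\<forall>v\<in>tangent_space M x. ((\<lambda>t. ex (t *\<^sub>R v)) has_vector_derivative v) (at 0))"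

definition kernel_on :: "'b set \<Rightarrow> ('b \<Rightarrow> 'c::zero) \<Rightarrow> 'b set" where
  "kernel_on V f = {w \<in> V. f w = 0}"

text \<open>The quotient \<open>V' / f(V)\<close>, as a set of cosets.\<close>

definition cokernel_on :: "'b set \<Rightarrow> 'c::plus set \<Rightarrow> ('b \<Rightarrow> 'c) \<Rightarrow> 'c set set" where
  "cokernel_on V V' f = (\<lambda>y. y +o f ` V) ` V'"

text \<open>
  \<open>D\<close> is the intrinsic derivative \<open>\<partial>\<^sub>v\<psi>(x) = k l'(0) i\<close> of the morphism \<open>\<psi>\<close> from \<open>F\<close> to \<open>F'\<close>,
  where \<open>l(t) = L(exp(tv))\<close> and \<open>L(y) = \<tau>'(y)\<^sup>-\<^sup>1 \<psi>(y) \<tau>(y)\<close>.  Only the values of \<open>D\<close> on the kernel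
  of \<open>\<psi> x\<close> matter.
\<close>

definition has_intrinsic_derivative ::
  "'a::euclidean_space set \<Rightarrow> ('a \<Rightarrow> 'b::euclidean_space set) \<Rightarrow> ('a \<Rightarrow> 'c::euclidean_space set) \<Rightarrow>
   ('a \<Rightarrow> 'b \<Rightarrow> 'c) \<Rightarrow> 'a \<Rightarrow> 'a \<Rightarrow> ('b \<Rightarrow> 'c set) \<Rightarrow> bool" where
  "has_intrinsic_derivative M F F' \<psi> x v D \<longleftrightarrow>
     (\<exists>\<tau> \<tau>' ex l'.
        trivialization_at M F x \<tau> \<and> trivialization_at M F' x \<tau>' \<and> exponential_at M x ex \<and>
        (\<forall>w\<in>F x. ((\<lambda>t. let y = ex (t *\<^sub>R v) in inv_into (F' x) (\<tau>' y) (\<psi> y (\<tau> y w)))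
                    has_vector_derivative l' w) (at 0)) \<and>
        (\<forall>w\<in>kernel_on (F x) (\<psi> x). D w = l' w +o \<psi> x ` F x))"

definition has_second_intrinsic_derivative ::
  "'a::euclidean_space set \<Rightarrow> 'b::euclidean_space set \<Rightarrow> ('a \<Rightarrow> 'b) \<Rightarrow> 'a \<Rightarrow> 'a \<Rightarrow>
   ('a \<Rightarrow> 'b set) \<Rightarrow> bool" where
  "has_second_intrinsic_derivative M N f x v D \<longleftrightarrow>
     has_intrinsic_derivative M (tangent_space M) (\<lambda>y. tangent_space N (f y))
       (differential M f) x v D"

text \<open>
  Being induced by a linear map, an intrinsic derivative is linear for the quotient structure on the
  cokernel, so it is an isomorphism precisely when it is bijective.
\<close>

definition second_intrinsic_derivative_iso ::
  "'a::euclidean_space set \<Rightarrow> 'b::euclidean_space set \<Rightarrow> ('a \<Rightarrow> 'b) \<Rightarrow> 'a \<Rightarrow> 'a \<Rightarrow> bool" where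
  "second_intrinsic_derivative_iso M N f x v \<longleftrightarrow>
     (\<exists>D. has_second_intrinsic_derivative M N f x v D \<and>
          bij_betw D (kernel_on (tangent_space M x) (differential M f x))
            (cokernel_on (tangent_space M x) (tangent_space N (f x)) (differential M f x)))"


section \<open>Smooth exchange economies\<close>

text \<open>
  Goods are indexed by \<open>'l\<close> and consumers by \<open>'m\<close>; \<open>n\<close> is the good whose price is normalized to 1.
\<close>

definition commodity_space :: "(real ^ 'l::finite) set" where
  "commodity_space = {x. \<forall>j. x $ j > 0}"

definition price_space :: "'l::finite \<Rightarrow> (real ^ 'l) set" where
  "price_space n = {p. (\<forall>j. p $ j > 0) \<and> p $ n = 1}"

definition economies :: "(real ^ 'l::finite ^ 'm::finite) set" where
  "economies = {\<omega>. \<forall>i. \<omega> $ i \<in> commodity_space}"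

text \<open>
  Since the gradient does not vanish, the tangent hyperplane at \<open>x\<close> to the indifference surface
  through \<open>x\<close> is the kernel of the derivative of \<open>u\<close> at \<open>x\<close>.
\<close>

definition smooth_utility :: "(real ^ 'l::finite \<Rightarrow> real) \<Rightarrow> bool" where
  "smooth_utility u \<longleftrightarrow>
     smooth_open commodity_space u \<and>
     (\<forall>x\<in>commodity_space. \<exists>g\<in>commodity_space. GDERIV u x :> g) \<and>
     (\<forall>x\<in>commodity_space. \<forall>v. v \<noteq> 0 \<and> frechet_derivative u (at x) v = 0 \<longrightarrow>
        frechet_derivative (\<lambda>y. frechet_derivative u (at y) v) (at x) v < 0) \<and>
     (\<forall>r. closed {x \<in> commodity_space. u x = r})"

definition demand :: "(real ^ 'l::finite \<Rightarrow> real) \<Rightarrow> real ^ 'l \<Rightarrow> real ^ 'l \<Rightarrow> real ^ 'l" where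
  "demand u p w = (THE x. is_arg_max u (\<lambda>x. x \<in> commodity_space \<and> p \<bullet> x \<le> p \<bullet> w) x)"

definition excess_demand ::
  "('m::finite \<Rightarrow> real ^ 'l::finite \<Rightarrow> real) \<Rightarrow> real ^ 'l \<Rightarrow> real ^ 'l ^ 'm \<Rightarrow> real ^ 'l" where
  "excess_demand u p \<omega> = (\<Sum>i\<in>UNIV. demand (u i) p (\<omega> $ i) - \<omega> $ i)"

text \<open>The natural projection of the equilibrium manifold is the restriction of \<^const>\<open>snd\<close>.\<close>

definition equilibrium_manifold ::
  "'l::finite \<Rightarrow> ('m::finite \<Rightarrow> real ^ 'l \<Rightarrow> real) \<Rightarrow> ((real ^ 'l) \<times> (real ^ 'l ^ 'm)) set" where
  "equilibrium_manifold n u =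
     {(p, \<omega>). p \<in> price_space n \<and> \<omega> \<in> economies \<and> excess_demand u p \<omega> = 0}"

definition equilibrium_prices ::
  "'l::finite \<Rightarrow> ('m::finite \<Rightarrow> real ^ 'l \<Rightarrow> real) \<Rightarrow> real ^ 'l ^ 'm \<Rightarrow> (real ^ 'l) set" where
  "equilibrium_prices n u \<omega> = {p \<in> price_space n. (p, \<omega>) \<in> equilibrium_manifold n u}"

definition regular_equilibrium ::
  "'l::finite \<Rightarrow> ('m::finite \<Rightarrow> real ^ 'l \<Rightarrow> real) \<Rightarrow> (real ^ 'l) \<times> (real ^ 'l ^ 'm) \<Rightarrow> bool" where
  "regular_equilibrium n u e \<longleftrightarrow>
     e \<in> equilibrium_manifold n u \<and>
     bij_betw (differential (equilibrium_manifold n u) snd e)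
       (tangent_space (equilibrium_manifold n u) e) (tangent_space economies (snd e))"

definition regular_economy ::
  "'l::finite \<Rightarrow> ('m::finite \<Rightarrow> real ^ 'l \<Rightarrow> real) \<Rightarrow> real ^ 'l ^ 'm \<Rightarrow> bool" where
  "regular_economy n u \<omega> \<longleftrightarrow>
     \<omega> \<in> economies \<and>
     (\<forall>e\<in>equilibrium_manifold n u. snd e = \<omega> \<longrightarrow>
        differential (equilibrium_manifold n u) snd e ` tangent_space (equilibrium_manifold n u) e
          = tangent_space economies \<omega>)"

definition crisis_transitions ::
  "'l::finite \<Rightarrow> ('m::finite \<Rightarrow> real ^ 'l \<Rightarrow> real) \<Rightarrow> ((real ^ 'l) \<times> (real ^ 'l ^ 'm)) set" where
  "crisis_transitions n u =
     {(p, \<omega>) \<in> equilibrium_manifold n u.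
        \<not> (\<exists>N q. open N \<and> \<omega> \<in> N \<and> N \<subseteq> economies \<and> continuous_on N q \<and>
               (\<forall>\<omega>'\<in>N. q \<omega>' \<in> equilibrium_prices n u \<omega>') \<and> q \<omega> = p)}"

text \<open>The infimum is taken in the extended reals, so that the distance to the empty set is infinite.\<close>

definition price_gap ::
  "'l::finite \<Rightarrow> ('m::finite \<Rightarrow> real ^ 'l \<Rightarrow> real) \<Rightarrow> real ^ 'l \<Rightarrow> real ^ 'l ^ 'm \<Rightarrow> ereal" where
  "price_gap n u p \<omega> = (INF q\<in>equilibrium_prices n u \<omega> - {p}. ereal (dist p q))"

definition lifting_from ::
  "'l::finite \<Rightarrow> ('m::finite \<Rightarrow> real ^ 'l \<Rightarrow> real) \<Rightarrow> (real \<Rightarrow> real ^ 'l ^ 'm) \<Rightarrow>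
   (real ^ 'l) \<times> (real ^ 'l ^ 'm) \<Rightarrow> (real \<Rightarrow> (real ^ 'l) \<times> (real ^ 'l ^ 'm)) \<Rightarrow> bool" where
  "lifting_from n u \<gamma> e g \<longleftrightarrow>
     path g \<and> path_image g \<subseteq> equilibrium_manifold n u \<and> pathstart g = e \<and>
     (\<forall>t\<in>{0..1}. snd (g t) = \<gamma> t)"

end

theory Submission
  imports Defs
begin

text \<open>
  An equilibrium is determined by as many coordinates as an economy has, so by invariance of domain
  the projection is a local homeomorphism wherever it has a continuous local section, that is, off
  the crisis transitions.  By the boundary behaviour of demand it is also proper.  Hence over a path
  that avoids the crisis economies it is a covering, and the path lifts uniquely.  The lift avoids
  the crisis transitions, so it cannot join points of different path components; its endpoint
  therefore differs from \<open>p\<^sub>+\<close>, and any other equilibrium price is at distance at least \<open>d\<close>.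
\<close>

section \<open>Proper local homeomorphisms\<close>

text \<open>
  Over a small neighbourhood of \<open>y\<close>, the part of \<open>c\<close> outside the sheets through the finitely many
  points of the fibre has closed image missing \<open>y\<close>, so the sheets alone make up the preimage.
\<close>

lemma compact_local_homeomorphism_imp_covering_space:
  fixes p :: "'a::metric_space \<Rightarrow> 'b::metric_space"
  assumes c: "compact c" and p: "continuous_on c p"
    and loc: "\<And>x. x \<in> c \<Longrightarrow> \<exists>V T q. x \<in> V \<and> openin (top_of_set c) V \<and>
                openin (top_of_set S) T \<and> homeomorphism V T p q"
    and pS: "p ` c \<subseteq> S" and S: "connected S" and "c \<noteq> {}"
  shows "covering_space c p S"
proof
  have closed_image: "closed (p ` K)" if "closedin (top_of_set c) K" for K
    using that c p
    by (meson closedin_compact closedin_imp_subset compact_continuous_image compact_imp_closed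
        continuous_on_subset)
  \<comment> \<open>The image is open by the local sheets and closed by compactness, so
    connectedness of \<open>S\<close> makes \<open>p\<close> surjective.\<close>
  have open_image: "openin (top_of_set S) (p ` c)"
  proof (subst openin_subopen, clarify)
    fix x assume "x \<in> c"
    then obtain V T q where V: "x \<in> V" "openin (top_of_set c) V" "openin (top_of_set S) T"
      "homeomorphism V T p q" using loc by blast
    then have "T = p ` V" "V \<subseteq> c" by (auto simp: homeomorphism_def openin_imp_subset)
    then show "\<exists>T. openin (top_of_set S) T \<and> p x \<in> T \<and> T \<subseteq> p ` c"
      using V by (intro exI[of _ T]) auto
  qed
  moreover have "closedin (top_of_set S) (p ` c)"
    using closed_image[of c] pS by (simp add: closed_subset)
  ultimately show onto: "p ` c = S"
    using S \<open>c \<noteq> {}\<close> unfolding connected_clopen by blast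
  show "continuous_on c p" by (rule p)
  fix y assume "y \<in> S"
  define F where "F = {x \<in> c. p x = y}"
  obtain V T q where V: "\<And>x. x \<in> c \<Longrightarrow> x \<in> V x" "\<And>x. x \<in> c \<Longrightarrow> openin (top_of_set c) (V x)"
    "\<And>x. x \<in> c \<Longrightarrow> openin (top_of_set S) (T x)" "\<And>x. x \<in> c \<Longrightarrow> homeomorphism (V x) (T x) p (q x)"
    using loc by metis
  have inj: "inj_on p (V x)" if "x \<in> c" for x
    using V(4)[OF that] by (metis homeomorphism_def inj_on_inverseI)
  have "closed F"
    using continuous_closedin_preimage_constant[OF p, of y] c
    unfolding F_def by (meson closedin_compact compact_imp_closed)
  then have "compact F"
    using c by (metis (no_types, lifting) F_def compact_Int_closed inf.absorb_iff2 mem_Collect_eq subsetI)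
  have "\<forall>x\<in>F. \<exists>O'. open O' \<and> V x = c \<inter> O'"
    using V(2) by (auto simp: F_def openin_open)
  then obtain O' where O': "\<And>x. x \<in> F \<Longrightarrow> open (O' x) \<and> V x = c \<inter> O' x"
    by metis
  \<comment> \<open>\<open>p\<close> is injective on each sheet, so a sheet meets the fibre only in
    its own centre. The centres of a finite subcover therefore exhaust the fibre, which is thus
    finite.\<close>
  have V_fibre: "V x \<inter> F = {x}" if "x \<in> F" for x
    using that V(1) inj[of x] unfolding F_def inj_on_def by blast
  obtain F' where F': "F' \<subseteq> F" "finite F'" "F \<subseteq> (\<Union>x\<in>F'. O' x)"
  proof (rule compactE_image[OF \<open>compact F\<close>, of F O'])
    show "open (O' x)" if "x \<in> F" for x using O' that by blast
    show "F \<subseteq> (\<Union>x\<in>F. O' x)" using O' V(1) by (fastforce simp: F_def)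
  qed auto
  have "F \<subseteq> F'"
  proof
    fix x assume "x \<in> F"
    then obtain x' where "x' \<in> F'" "x \<in> O' x'" using F'(3) by blast
    moreover have "x \<in> c" using \<open>x \<in> F\<close> by (simp add: F_def)
    ultimately have "x \<in> V x' \<inter> F" using O'[of x'] F'(1) \<open>x \<in> F\<close> by blast
    then have "x = x'" using V_fibre[of x'] F'(1) \<open>x' \<in> F'\<close> by (metis singletonD subsetD)
    then show "x \<in> F'" using \<open>x' \<in> F'\<close> by simp
  qed
  then have finF: "finite F" using F'(2) finite_subset by blast
  obtain A where A: "\<And>x. x \<in> F \<Longrightarrow> open (A x) \<and> x \<in> A x"
    "\<And>x x'. x \<in> F \<Longrightarrow> x' \<in> F \<Longrightarrow> x \<noteq> x' \<Longrightarrow> A x \<inter> A x' = {}"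
  proof -
    obtain d where d: "d > 0" "\<And>x x'. x \<in> F \<Longrightarrow> x' \<in> F \<Longrightarrow> x \<noteq> x' \<Longrightarrow> d \<le> dist x x'"
    proof -
      \<comment> \<open>Inserting 1 keeps \<open>D\<close> nonempty when the fibre is a single
        point; deleting 0 makes its minimum positive. Balls of half this radius then separate the
        sheets.\<close>
      define D where "D = insert 1 ((\<lambda>(x, x'). dist x x') ` (F \<times> F) - {0})"
      have "finite D" using finF by (simp add: D_def)
      then have "0 < Min D" "\<And>r. r \<in> D \<Longrightarrow> Min D \<le> r"
        by (auto simp: D_def)
      moreover have "dist x x' \<in> D" if "x \<in> F" "x' \<in> F" "x \<noteq> x'" for x x'
        using that unfolding D_def by (force simp: image_iff)
      ultimately show ?thesis by (intro that[of "Min D"]) simp_all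
    qed
    show ?thesis
    proof (rule that[of "\<lambda>x. ball x (d/2)"])
      show "ball x (d/2) \<inter> ball x' (d/2) = {}" if "x \<in> F" "x' \<in> F" "x \<noteq> x'" for x x'
        using d(2)[OF that] by (intro disjoint_ballI) auto
    qed (use d in auto)
  qed
  define W where "W x = V x \<inter> A x" for x
  have W: "x \<in> W x" "openin (top_of_set c) (W x)" "W x \<subseteq> V x" "W x \<subseteq> c" if "x \<in> F" for x
  proof -
    have "x \<in> c" using that by (simp add: F_def)
    then show "x \<in> W x" using V(1) A(1)[OF that] by (simp add: W_def)
    show "openin (top_of_set c) (W x)"
      unfolding W_def using V(2)[OF \<open>x \<in> c\<close>] A(1)[OF that] by (simp add: openin_Int_open)
    then show "W x \<subseteq> c" by (rule openin_imp_subset)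
  qed (simp add: W_def)
  have pW: "openin (top_of_set S) (p ` W x)" if "x \<in> F" for x
  proof -
    have x: "x \<in> c" using that by (simp add: F_def)
    have "openin (top_of_set (V x)) (W x)"
      using W[OF that] V(2)[OF x] by (meson openin_subset_trans openin_imp_subset)
    then have "openin (top_of_set (T x)) (p ` W x)"
      by (rule homeomorphism_imp_open_map[OF V(4)[OF x]])
    then show ?thesis using V(3)[OF x] openin_trans by blast
  qed
  \<comment> \<open>The intersection makes each sheet map onto all of \<open>N\<close>, and it stays
    open because the fibre is finite.\<close>
  define N where "N = S \<inter> (\<Inter>x\<in>F. p ` W x) - p ` (c - (\<Union>x\<in>F. W x))"
  have N: "openin (top_of_set S) N"
  proof -
    have "openin (top_of_set S) (S \<inter> (\<Inter>x\<in>F. p ` W x))"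
      using openin_INT[OF finF pW] by (simp add: Int_commute)
    moreover have "closedin (top_of_set c) (c - (\<Union>x\<in>F. W x))"
      using W(2) by (auto intro!: closedin_diff openin_Union)
    ultimately show ?thesis
      unfolding N_def using closed_image by (metis (no_types) Diff_eq open_Compl openin_Int_open)
  qed
  have yN: "y \<in> N"
    using \<open>y \<in> S\<close> W(1) unfolding N_def by (fastforce simp: F_def)
  define v where "v = (\<lambda>x. W x \<inter> p -` N) ` F"
  show "\<exists>T. y \<in> T \<and> openin (top_of_set S) T \<and>
         (\<exists>v. \<Union> v = c \<inter> p -` T \<and> (\<forall>u\<in>v. openin (top_of_set c) u) \<and>
              pairwise disjnt v \<and> (\<forall>u\<in>v. \<exists>q. homeomorphism u T p q))"
  proof (intro exI[of _ N] exI[of _ v] conjI ballI)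
    show "\<Union> v = c \<inter> p -` N"
      using W(4) unfolding v_def N_def by blast
    show "pairwise disjnt v"
      using A(2) unfolding v_def W_def pairwise_def disjnt_def by blast
  next
    fix Z assume "Z \<in> v"
    then obtain x where x: "x \<in> F" "Z = W x \<inter> p -` N" by (auto simp: v_def)
    have "Z = W x \<inter> (c \<inter> p -` N)" using W(4)[OF x(1)] x(2) by blast
    moreover have "openin (top_of_set c) (c \<inter> p -` N)"
      using p N onto by (simp add: continuous_on_open)
    ultimately show "openin (top_of_set c) Z"
      using W(2)[OF x(1)] by auto
    have "p ` Z = p ` W x \<inter> N" using x(2) by blast
    also have "\<dots> = N" using x(1) by (auto simp: N_def)
    finally have "p ` Z = N" .
    moreover have "Z \<subseteq> V x" using W(3)[OF x(1)] x(2) by blast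
    moreover have "homeomorphism (V x) (T x) p (q x)"
      using V(4) x(1) by (simp add: F_def)
    ultimately have "homeomorphism Z N p (q x)"
      using homeomorphism_of_subsets[of "V x" "T x" p "q x" Z "T x" N] by simp
    then show "\<exists>q. homeomorphism Z N p q" by blast
  qed (use yN N in auto)
qed

section \<open>Demand\<close>

lemma convex_commodity_space: "convex (commodity_space :: (real^'l::finite) set)"
  unfolding convex_def commodity_space_def
proof (clarsimp, goal_cases)
  case (1 x y a b j)
  then have "0 \<le> a * x $ j" "0 \<le> b * y $ j"
    by (simp_all add: less_imp_le)
  moreover from 1 have "a * x $ j \<noteq> 0 \<or> b * y $ j \<noteq> 0"
    by (metis add_0 less_irrefl mult_eq_0_iff zero_neq_one)
  ultimately show ?case by linarith
qed

lemma segment_in_commodity_space: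
  assumes "x \<in> commodity_space" "y \<in> commodity_space" "0 \<le> t" "t \<le> 1"
  shows "x + t *\<^sub>R (y - x) \<in> commodity_space"
proof -
  have "(1 - t) *\<^sub>R x + t *\<^sub>R y \<in> commodity_space"
    using convexD_alt[OF convex_commodity_space assms] .
  then show ?thesis by (simp add: algebra_simps)
qed

lemma has_real_derivative_along_line:
  fixes f :: "'a::euclidean_space \<Rightarrow> real"
  assumes "f differentiable (at (x + t *\<^sub>R v))"
  shows "((\<lambda>t. f (x + t *\<^sub>R v)) has_real_derivative
           frechet_derivative f (at (x + t *\<^sub>R v)) v) (at t)"
proof -
  let ?D = "frechet_derivative f (at (x + t *\<^sub>R v))"
  have D: "(f has_derivative ?D) (at (x + t *\<^sub>R v))"
    using assms by (simp add: frechet_derivative_works)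
  have "((\<lambda>t. f (x + t *\<^sub>R v)) has_derivative (\<lambda>s. ?D (s *\<^sub>R v))) (at t)"
    by (rule has_derivative_compose[where f="\<lambda>t. x + t *\<^sub>R v", OF _ D]) (auto intro!: derivative_eq_intros)
  moreover have "(\<lambda>s. ?D (s *\<^sub>R v)) = (*) (?D v)"
    using D by (auto simp: fun_eq_iff linear_cmul has_derivative_linear)
  ultimately show ?thesis by (simp add: has_field_derivative_def)
qed

section \<open>Consequences of the utility axioms\<close>

context
  fixes u :: "real^'l::finite \<Rightarrow> real"
  assumes utility: "smooth_utility u"
begin

lemma utility_Ck: "Ck_on k commodity_space u"
  using utility unfolding smooth_utility_def smooth_open_def by blast

lemma utility_differentiable: "x \<in> commodity_space \<Longrightarrow> u differentiable (at x)"
  using utility_Ck[of "Suc 0"] by simp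

lemma utility_derivative_differentiable:
  "x \<in> commodity_space \<Longrightarrow> (\<lambda>y. frechet_derivative u (at y) v) differentiable (at x)"
  using utility_Ck[of "Suc (Suc 0)"] by simp

lemma utility_continuous: "continuous_on commodity_space u"
  using utility_Ck[of 0] by simp

lemma utility_isCont: "x \<in> commodity_space \<Longrightarrow> isCont u x"
  using utility_differentiable differentiable_imp_continuous_within by blast

text \<open>Along the segment the derivative of \<open>u\<close> is the inner product of the
  nonnegative nonzero vector \<open>y - x\<close> with a strictly positive gradient.\<close>

lemma utility_strict_mono:
  assumes x: "x \<in> commodity_space" and y: "y \<in> commodity_space"
    and le: "\<And>j. x $ j \<le> y $ j" and "x \<noteq> y"
  shows "u x < u y"
proof -
  define v where "v = y - x"
  have "\<exists>d. ((\<lambda>t. u (x + t *\<^sub>R v)) has_real_derivative d) (at t) \<and> 0 < d"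
    if t: "0 \<le> t" "t \<le> 1" for t
  proof -
    have X: "x + t *\<^sub>R v \<in> commodity_space"
      unfolding v_def using segment_in_commodity_space[OF x y t] .
    then obtain g where g: "g \<in> commodity_space" "GDERIV u (x + t *\<^sub>R v) :> g"
      using utility unfolding smooth_utility_def by blast
    have "frechet_derivative u (at (x + t *\<^sub>R v)) = (\<lambda>h. h \<bullet> g)"
      using g(2) unfolding gderiv_def by (rule frechet_derivative_at[symmetric])
    moreover have "0 < v \<bullet> g"
    proof -
      obtain j where "x $ j \<noteq> y $ j" using \<open>x \<noteq> y\<close> by (auto simp: vec_eq_iff)
      with le[of j] have "0 < v $ j * g $ j"
        using g(1) by (intro mult_pos_pos) (auto simp: v_def commodity_space_def)
      moreover have "0 \<le> v $ i * g $ i" for i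
        using g(1) le[of i]
        by (intro mult_nonneg_nonneg) (auto simp: v_def commodity_space_def less_imp_le)
      ultimately show ?thesis
        unfolding inner_vec_def by (intro sum_pos2[where i=j]) auto
    qed
    ultimately show ?thesis
      using has_real_derivative_along_line[OF utility_differentiable[OF X]] by auto
  qed
  then have "u (x + 0 *\<^sub>R v) < u (x + 1 *\<^sub>R v)"
    by (intro DERIV_pos_imp_increasing[where f="\<lambda>t. u (x + t *\<^sub>R v)"]) auto
  then show ?thesis by (simp add: v_def)
qed

text \<open>Otherwise \<open>u\<close> restricted to the segment has an interior minimum. There the
  direction is tangent to the indifference surface, so the second derivative is negative by strict
  quasi-concavity, which is impossible at a minimum.\<close>

lemma utility_midpoint_greater:
  assumes x: "x \<in> commodity_space" and y: "y \<in> commodity_space"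
    and "x \<noteq> y" and eq: "u x = u y"
  shows "u x < u (x + (1/2) *\<^sub>R (y - x))"
proof (rule ccontr)
  assume neg: "\<not> ?thesis"
  define v where "v = y - x"
  define h where "h = (\<lambda>t. u (x + t *\<^sub>R v))"
  define h' where "h' = (\<lambda>t. frechet_derivative u (at (x + t *\<^sub>R v)) v)"
  have X: "x + t *\<^sub>R v \<in> commodity_space" if "0 \<le> t" "t \<le> 1" for t
    unfolding v_def using segment_in_commodity_space[OF x y that] .
  have v0: "v \<noteq> 0" using \<open>x \<noteq> y\<close> by (simp add: v_def)
  have h: "(h has_real_derivative h' t) (at t)" if "0 \<le> t" "t \<le> 1" for t
    unfolding h_def h'_def
    by (rule has_real_derivative_along_line[OF utility_differentiable[OF X[OF that]]])
  have h'': "\<exists>d<0. (h' has_real_derivative d) (at t)" if "0 \<le> t" "t \<le> 1" "h' t = 0" for t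
  proof (intro exI conjI)
    show "(h' has_real_derivative
        frechet_derivative (\<lambda>y. frechet_derivative u (at y) v) (at (x + t *\<^sub>R v)) v) (at t)"
      unfolding h'_def
      by (rule has_real_derivative_along_line[OF utility_derivative_differentiable[OF X[OF that(1,2)]]])
    show "frechet_derivative (\<lambda>y. frechet_derivative u (at y) v) (at (x + t *\<^sub>R v)) v < 0"
      using utility X[OF that(1,2)] v0 that(3) unfolding smooth_utility_def h'_def by blast
  qed
  have cont: "continuous_on {0..1} h"
    using h by (intro DERIV_continuous_on) (auto intro: has_field_derivative_at_within)
  then obtain t0 where t0: "t0 \<in> {0..1}" "\<And>s. s \<in> {0..1} \<Longrightarrow> h t0 \<le> h s"
    using continuous_attains_inf[of "{0..1::real}" h] by auto
  have ends: "h (1/2) \<le> h 0" "h 0 = h 1" using neg eq by (auto simp: h_def v_def)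
  \<comment> \<open>If the minimum is attained at an endpoint, the negated claim makes the midpoint
    a minimum as well.\<close>
  obtain t where t: "0 < t" "t < 1" "\<And>s. s \<in> {0..1} \<Longrightarrow> h t \<le> h s"
  proof (cases "t0 = 0 \<or> t0 = 1")
    case True
    then have "h (1/2) \<le> h s" if "s \<in> {0..1}" for s using t0(2)[OF that] ends by auto
    then show ?thesis using that[of "1/2"] by auto
  next
    case False
    then show ?thesis using that[of t0] t0 by auto
  qed
  have crit: "h' t = 0"
  proof (rule DERIV_local_min)
    show "(h has_real_derivative h' t) (at t)" using h t by simp
    show "0 < min t (1 - t)" using t by simp
    show "\<forall>y. \<bar>t - y\<bar> < min t (1 - t) \<longrightarrow> h t \<le> h y"
      using t(3) by (auto simp: abs_less_iff)
  qed
  then obtain d where "d < 0" "(h' has_real_derivative d) (at t)"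
    using h''[of t] crit t by (auto simp: less_imp_le)
  \<comment> \<open>\<open>h'\<close> vanishes at \<open>t\<close> and has negative derivative
    there, so it is negative just to the right and \<open>h\<close> drops below its minimum.\<close>
  then obtain e where e: "e > 0" "\<And>s. 0 < s \<Longrightarrow> s < e \<Longrightarrow> h' (t + s) < 0"
    using DERIV_neg_dec_right[of h' d t] crit by auto
  define r where "r = min e (1 - t) / 2"
  have r: "0 < r" "r < e" "t + r < 1" using e(1) t by (auto simp: r_def min_def field_simps)
  have "h (t + r) < h t"
  proof (rule DERIV_neg_imp_decreasing_open[where f=h])
    show "\<exists>y. (h has_real_derivative y) (at s) \<and> y < 0" if "t < s" "s < t + r" for s
      using h[of s] e(2)[of "s - t"] that r t by auto
    show "continuous_on {t..t + r} h"
      using cont by (rule continuous_on_subset) (use r t in auto)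
  qed (use r in auto)
  moreover have "h t \<le> h (t + r)" by (rule t(3)) (use r t in auto)
  ultimately show False by simp
qed

text \<open>The axioms only give closed level surfaces. Each term of a convergent sequence is shrunk
  along its ray onto the surface through \<open>w\<close>. The factors subconverge to some
  \<open>c\<close> in \<open>{0..1}\<close>, and \<open>c *\<^sub>R a\<close> lies on that closed
  surface; hence \<open>a\<close> has positive entries, and continuity gives the inequality.\<close>

lemma closed_upper_contour_set:
  assumes w: "w \<in> commodity_space"
  shows "closed {x \<in> commodity_space. u w \<le> u x}"
  unfolding closed_sequential_limits
proof (intro allI impI)
  fix x :: "nat \<Rightarrow> real^'l" and a
  assume asm: "(\<forall>k. x k \<in> {x \<in> commodity_space. u w \<le> u x}) \<and> x \<longlonglongrightarrow> a"
  then have x: "x k \<in> commodity_space" "u w \<le> u (x k)" and lim: "x \<longlonglongrightarrow> a" for k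
    by auto
  have "\<exists>s. 0 \<le> s \<and> s \<le> 1 \<and> s *\<^sub>R x k \<in> commodity_space \<and> u (s *\<^sub>R x k) = u w" for k
  proof -
    \<comment> \<open>The largest factor in (0,1] that brings \<open>x k\<close> below
      \<open>w\<close> in every coordinate. The utility there is at most \<open>u w\<close>, so the
      intermediate value theorem yields the required factor between \<open>s0\<close> and 1.\<close>
    define s0 where "s0 = Min (insert 1 (range (\<lambda>j. w $ j / x k $ j)))"
    have s0: "0 < s0" "s0 \<le> 1" "s0 \<le> w $ j / x k $ j" for j
      unfolding s0_def using w x(1)[of k] by (auto simp: commodity_space_def intro!: min.coboundedI2)
    have X: "s *\<^sub>R x k \<in> commodity_space" if "s0 \<le> s" for s
      using that s0(1) x(1)[of k] by (auto simp: commodity_space_def)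
    have "(s0 *\<^sub>R x k) $ j \<le> w $ j" for j
      using s0(3)[of j] x(1)[of k] by (auto simp: commodity_space_def pos_le_divide_eq)
    then have "u (s0 *\<^sub>R x k) \<le> u w"
      using utility_strict_mono[OF X[OF order_refl] w] by (cases "s0 *\<^sub>R x k = w") auto
    moreover have "continuous_on {s0..1} (\<lambda>s. u (s *\<^sub>R x k))"
      by (rule continuous_on_compose2[OF utility_continuous])
         (use X in \<open>auto intro!: continuous_intros\<close>)
    ultimately obtain s where "s0 \<le> s" "s \<le> 1" "u (s *\<^sub>R x k) = u w"
      using IVT'[of "\<lambda>s. u (s *\<^sub>R x k)" s0 "u w" 1] x(2)[of k] s0 by auto
    then show ?thesis using X s0 by (intro exI[of _ s]) auto
  qed
  then have "\<exists>s. \<forall>k. 0 \<le> s k \<and> s k \<le> 1 \<and> s k *\<^sub>R x k \<in> commodity_space \<and>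
      u (s k *\<^sub>R x k) = u w"
    by (intro choice allI)
  then obtain s where s: "\<And>k. s k \<in> {0..1}"
    "\<And>k. s k *\<^sub>R x k \<in> {y \<in> commodity_space. u y = u w}"
    by auto
  obtain c r where c: "c \<in> {0..1::real}" and r: "strict_mono r" and sc: "(s \<circ> r) \<longlonglongrightarrow> c"
    using seq_compactE[OF compact_imp_seq_compact[OF compact_Icc], of s 0 1] s(1) by blast
  have "closed {y \<in> commodity_space. u y = u w}"
    using utility unfolding smooth_utility_def by blast
  moreover have "(s \<circ> r) k *\<^sub>R (x \<circ> r) k \<in> {y \<in> commodity_space. u y = u w}" for k
    using s(2)[of "r k"] by simp
  moreover have "(\<lambda>k. (s \<circ> r) k *\<^sub>R (x \<circ> r) k) \<longlonglongrightarrow> c *\<^sub>R a"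
    using sc LIMSEQ_subseq_LIMSEQ[OF lim r] by (rule tendsto_scaleR)
  ultimately have "c *\<^sub>R a \<in> {y \<in> commodity_space. u y = u w}"
    by (rule closed_sequentially)
  then have a: "a \<in> commodity_space"
    using c by (simp add: commodity_space_def zero_less_mult_iff)
  moreover have "u w \<le> u a"
    by (rule LIMSEQ_le_const[OF isCont_tendsto_compose[OF utility_isCont[OF a] lim]]) (use x in auto)
  ultimately show "a \<in> {x \<in> commodity_space. u w \<le> u x}" by simp
qed

section \<open>Existence and uniqueness of the demanded bundle\<close>

text \<open>Among affordable bundles only those at least as good as \<open>w\<close> matter. They
  form a set that is closed by the upper contour lemma, and bounded because no coordinate can exceed
  income divided by its price.\<close>

lemma budget_maximizer_exists:
  assumes p: "\<And>j. 0 < p $ j" and w: "w \<in> commodity_space"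
  shows "\<exists>x. is_arg_max u (\<lambda>x. x \<in> commodity_space \<and> p \<bullet> x \<le> p \<bullet> w) x"
proof -
  define K where "K = {x \<in> commodity_space. u w \<le> u x} \<inter> {x. p \<bullet> x \<le> p \<bullet> w}"
  have bound: "norm x \<le> norm (\<chi> j. p \<bullet> w / p $ j)" if "x \<in> K" for x
  proof (rule norm_le_componentwise_cart)
    fix j
    have x: "0 < x $ i" for i using that by (auto simp: K_def commodity_space_def)
    have "p $ j * x $ j \<le> p \<bullet> x"
      unfolding inner_vec_def inner_real_def
      by (rule member_le_sum) (use x p in \<open>auto intro: mult_nonneg_nonneg less_imp_le\<close>)
    also have "\<dots> \<le> p \<bullet> w" using that by (simp add: K_def)
    finally have "x $ j \<le> p \<bullet> w / p $ j" using p[of j] by (simp add: pos_le_divide_eq mult.commute)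
    then show "norm (x $ j) \<le> norm ((\<chi> j. p \<bullet> w / p $ j) $ j)"
      unfolding vec_lambda_beta real_norm_def using x[of j] by linarith
  qed
  have "closed K"
    unfolding K_def by (intro closed_Int closed_upper_contour_set w closed_halfspace_le)
  moreover have "bounded K" using bound unfolding bounded_iff by blast
  ultimately have "compact K" by (simp add: compact_eq_bounded_closed)
  moreover have "w \<in> K" using w by (simp add: K_def)
  moreover have "continuous_on K u"
    by (rule continuous_on_subset[OF utility_continuous]) (auto simp: K_def)
  ultimately obtain x where x: "x \<in> K" "\<And>y. y \<in> K \<Longrightarrow> u y \<le> u x"
    using continuous_attains_sup[of K u] by blast
  have "u y \<le> u x" if "y \<in> commodity_space" "p \<bullet> y \<le> p \<bullet> w" for y
    using x(2)[of y] x(2)[OF \<open>w \<in> K\<close>] that by (cases "u w \<le> u y") (auto simp: K_def)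
  then show ?thesis
    using x(1) by (intro exI[of _ x]) (auto simp: is_arg_max_def K_def not_less)
qed

text \<open>The midpoint of two distinct maximizers would be affordable and strictly better.\<close>

lemma budget_maximizer_unique:
  assumes x: "is_arg_max u (\<lambda>x. x \<in> commodity_space \<and> p \<bullet> x \<le> p \<bullet> w) x"
    and y: "is_arg_max u (\<lambda>x. x \<in> commodity_space \<and> p \<bullet> x \<le> p \<bullet> w) y"
  shows "x = y"
proof (rule ccontr)
  assume "x \<noteq> y"
  have X: "x \<in> commodity_space" "y \<in> commodity_space" and "u x = u y"
    using x y by (auto simp: is_arg_max_def not_less intro: order_antisym)
  let ?m = "x + (1/2) *\<^sub>R (y - x)"
  have "u x < u ?m"
    using utility_midpoint_greater[OF X \<open>x \<noteq> y\<close> \<open>u x = u y\<close>] .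
  moreover have "?m \<in> commodity_space" by (rule segment_in_commodity_space[OF X]) auto
  moreover have "p \<bullet> ?m \<le> p \<bullet> w"
    using x y by (auto simp: is_arg_max_def inner_add_right inner_diff_right field_simps)
  ultimately show False using x by (auto simp: is_arg_max_def)
qed

lemma demand_eqI:
  assumes "is_arg_max u (\<lambda>x. x \<in> commodity_space \<and> p \<bullet> x \<le> p \<bullet> w) x"
  shows "demand u p w = x"
  unfolding demand_def using assms by (rule the_equality) (rule budget_maximizer_unique[OF _ assms])

lemma demand_is_arg_max:
  assumes "\<And>j. 0 < p $ j" and "w \<in> commodity_space"
  shows "is_arg_max u (\<lambda>x. x \<in> commodity_space \<and> p \<bullet> x \<le> p \<bullet> w) (demand u p w)"
  using budget_maximizer_exists[OF assms] demand_eqI by metis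

end


section \<open>The natural projection\<close>

lemma demand_cong:
  assumes "p \<bullet> w = p \<bullet> w'"
  shows "demand u p w = demand u p w'"
  unfolding demand_def using assms by simp

text \<open>
  Incomes, the non-numeraire holdings of all consumers but \<open>k\<close>, and prices (stored in the otherwise
  unused row \<open>k\<close>) determine an equilibrium, because demand depends only on prices and income.
\<close>

definition equilibrium_chart ::
  "'l \<Rightarrow> 'm \<Rightarrow> (real^'l::finite) \<times> (real^'l^'m::finite) \<Rightarrow> real^'l^'m" where
  "equilibrium_chart n k e =
     (\<chi> i j. if j = n then fst e \<bullet> snd e $ i else if i = k then fst e $ j else snd e $ i $ j)"

lemma continuous_on_equilibrium_chart: "continuous_on A (equilibrium_chart n k)"
  unfolding equilibrium_chart_def
proof (intro continuous_on_vec_lambda)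
  fix i j
  show "continuous_on A (\<lambda>e. if j = n then fst e \<bullet> snd e $ i
      else if i = k then fst e $ j else snd e $ i $ j)"
    by (cases "j = n"; cases "i = k") (auto intro!: continuous_intros)
qed

lemma vec_eq_of_inner_eq:
  fixes x y p :: "real^'l::finite"
  assumes "p $ n \<noteq> 0" "\<And>j. j \<noteq> n \<Longrightarrow> x $ j = y $ j" "p \<bullet> x = p \<bullet> y"
  shows "x = y"
proof -
  have "p \<bullet> (x - y) = (\<Sum>j\<in>UNIV. p $ j * (x - y) $ j)" by (simp add: inner_vec_def)
  also have "\<dots> = (\<Sum>j\<in>{n}. p $ j * (x - y) $ j)"
    by (rule sum.mono_neutral_right) (use assms(2) in auto)
  finally have "x $ n = y $ n" using assms(1,3) by (simp add: inner_diff_right)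
  then show ?thesis using assms(2) by (metis vec_eq_iff)
qed

text \<open>Prices are read off row \<open>k\<close>; income and non-numeraire holdings then give
  the endowments of all other consumers. Equal prices and incomes mean equal demands, so market
  clearing fixes the total endowment and with it that of consumer \<open>k\<close>.\<close>

lemma inj_on_equilibrium_chart:
  "inj_on (equilibrium_chart n k) (equilibrium_manifold n u)"
proof (rule inj_onI, clarify)
  fix p q \<omega> \<eta>
  assume e: "(p, \<omega>) \<in> equilibrium_manifold n u" and f: "(q, \<eta>) \<in> equilibrium_manifold n u"
    and eq: "equilibrium_chart n k (p, \<omega>) = equilibrium_chart n k (q, \<eta>)"
  have c: "(if j = n then p \<bullet> \<omega> $ i else if i = k then p $ j else \<omega> $ i $ j) =
           (if j = n then q \<bullet> \<eta> $ i else if i = k then q $ j else \<eta> $ i $ j)" for i j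
    using arg_cong[OF eq, of "\<lambda>z. z $ i $ j"]
    unfolding equilibrium_chart_def fst_conv snd_conv vec_lambda_beta .
  have n: "p $ n = 1" "q $ n = 1"
    using e f by (auto simp: equilibrium_manifold_def price_space_def)
  have "p = q"
    unfolding vec_eq_iff using c[of _ k] n by metis
  have inc: "p \<bullet> \<omega> $ i = p \<bullet> \<eta> $ i" for i using c[of n i] \<open>p = q\<close> by simp
  have other: "\<omega> $ i = \<eta> $ i" if "i \<noteq> k" for i
  proof (rule vec_eq_of_inner_eq[of p n])
    show "\<omega> $ i $ j = \<eta> $ i $ j" if "j \<noteq> n" for j
      using c[of j i] \<open>i \<noteq> k\<close> that by simp
  qed (use n inc in auto)
  have "demand (u i) p (\<omega> $ i) = demand (u i) p (\<eta> $ i)" for i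
    using inc by (rule demand_cong)
  then have "(\<Sum>i\<in>UNIV. \<omega> $ i) = (\<Sum>i\<in>UNIV. \<eta> $ i)"
    using e f \<open>p = q\<close> by (simp add: equilibrium_manifold_def excess_demand_def sum_subtractf)
  then have "\<omega> $ k = \<eta> $ k"
    using other by (simp add: sum.remove[of UNIV k])
  with other have "\<omega> = \<eta>" by (metis vec_eq_iff)
  with \<open>p = q\<close> show "p = q \<and> \<omega> = \<eta>" by simp
qed

text \<open>
  A continuous selection of equilibria is an injective map between spaces of equal dimension, so
  invariance of domain makes its graph an open subset of the equilibrium manifold.
\<close>

lemma local_homeomorphism_off_crises:
  assumes "e \<in> equilibrium_manifold n u - crisis_transitions n u"
  shows "\<exists>V N s. e \<in> V \<and> openin (top_of_set (equilibrium_manifold n u)) V \<and> open N \<and>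
           homeomorphism V N snd s"
proof -
  obtain p \<omega> where e: "e = (p, \<omega>)" by fastforce
  obtain N q where N: "open N" "\<omega> \<in> N" "continuous_on N q"
    "\<And>\<eta>. \<eta> \<in> N \<Longrightarrow> q \<eta> \<in> equilibrium_prices n u \<eta>" "q \<omega> = p"
    using assms unfolding e crisis_transitions_def by blast
  define s where "s = (\<lambda>\<eta>. (q \<eta>, \<eta>))"
  \<comment> \<open>Any consumer may play the part of \<open>k\<close>; \<open>undefined\<close> is
    an arbitrary one.\<close>
  define f where "f = equilibrium_chart n (undefined :: 'b)"
  let ?E = "equilibrium_manifold n u"
  have s: "continuous_on N s" "s ` N \<subseteq> ?E"
    using N(3,4) by (auto simp: s_def equilibrium_prices_def intro!: continuous_intros)
  have inj: "inj_on f ?E" unfolding f_def by (rule inj_on_equilibrium_chart)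
  have "inj_on (f \<circ> s) N"
    by (rule comp_inj_on) (use inj s(2) in \<open>auto simp: s_def inj_on_def\<close>)
  moreover have "continuous_on N (f \<circ> s)"
    using s(1) continuous_on_equilibrium_chart unfolding f_def by (rule continuous_on_compose)
  ultimately have "open ((f \<circ> s) ` N)"
    using N(1) by (rule invariance_of_domain[rotated 2])
  \<comment> \<open>Injectivity of the chart on the manifold makes the graph the full preimage of an
    open set, hence relatively open.\<close>
  moreover have "s ` N = ?E \<inter> f -` ((f \<circ> s) ` N)"
    using s(2) inj by (auto simp: inj_on_def)
  ultimately have "openin (top_of_set ?E) (s ` N)"
    using continuous_openin_preimage_gen[of ?E f "(f \<circ> s) ` N"] continuous_on_equilibrium_chart
    unfolding f_def by metis
  moreover have "homeomorphism (s ` N) N snd s"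
    unfolding homeomorphism_def using s(1) by (auto simp: s_def image_iff intro!: continuous_intros)
  moreover have "e \<in> s ` N" using N by (auto simp: e s_def)
  ultimately show ?thesis using N(1) by blast
qed

section \<open>Properness of the projection\<close>

text \<open>
  With prices rescaled to norm 1, a subsequence of prices and demands converges.  In the limit each
  consumer still maximizes utility, which by monotonicity is impossible at a price vector with a
  vanishing entry, so rescaling back to the numeraire is harmless.
\<close>

lemma equilibrium_prices_subsequence_limit:
  fixes u :: "'m::finite \<Rightarrow> real^'l::finite \<Rightarrow> real"
  assumes u: "\<And>i. smooth_utility (u i)"
    and E: "\<And>k. (p k, \<omega> k) \<in> equilibrium_manifold n u"
    and lim: "\<omega> \<longlonglongrightarrow> \<eta>" and \<eta>: "\<eta> \<in> economies"
  shows "\<exists>q r. strict_mono r \<and> (p \<circ> r) \<longlonglongrightarrow> q \<and> (q, \<eta>) \<in> equilibrium_manifold n u"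
proof -
  define x where "x k = (\<chi> i. demand (u i) (p k) (\<omega> k $ i))" for k
  have p: "p k $ j > 0" "p k $ n = 1" for k j
    using E[of k] by (auto simp: equilibrium_manifold_def price_space_def)
  have \<omega>: "\<omega> k $ i \<in> commodity_space" for k i
    using E[of k] by (auto simp: equilibrium_manifold_def economies_def)
  have x: "is_arg_max (u i) (\<lambda>y. y \<in> commodity_space \<and> p k \<bullet> y \<le> p k \<bullet> \<omega> k $ i) (x k $ i)" for k i
    using demand_is_arg_max[OF u p(1) \<omega>] by (simp add: x_def)
  have xX: "x k $ i \<in> commodity_space" and xb: "p k \<bullet> x k $ i \<le> p k \<bullet> \<omega> k $ i"
    and xm: "\<And>y. y \<in> commodity_space \<Longrightarrow> p k \<bullet> y \<le> p k \<bullet> \<omega> k $ i \<Longrightarrow> u i y \<le> u i (x k $ i)" for k i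
    using x[where k=k and i=i] by (auto simp: is_arg_max_def not_less)
  have market: "(\<Sum>i\<in>UNIV. x k $ i) = (\<Sum>i\<in>UNIV. \<omega> k $ i)" for k
    using E[of k] by (simp add: equilibrium_manifold_def excess_demand_def x_def sum_subtractf)
  define \<pi> where "\<pi> k = p k /\<^sub>R norm (p k)" for k
  have p0: "norm (p k) > 0" for k using p(2)[of k] by auto
  have pos: "\<pi> k $ j > 0" for k j using p p0 by (simp add: \<pi>_def)
  \<comment> \<open>Demands are positive and sum to the total endowment, which converges. Every
    entry of a demand is thus bounded by the corresponding total.\<close>
  have "bounded (range (\<lambda>k. \<Sum>i\<in>UNIV. \<omega> k $ i))"
    by (rule convergent_imp_bounded[of _ "\<Sum>i\<in>UNIV. \<eta> $ i"]) (intro tendsto_intros lim)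
  then obtain B where B: "\<And>k. norm (\<Sum>i\<in>UNIV. \<omega> k $ i) \<le> B"
    unfolding bounded_iff by blast
  have "norm (x k) \<le> CARD('m) * B" for k
  proof -
    have "norm (x k $ i) \<le> B" for i
    proof -
      have "norm (x k $ i $ j) \<le> norm ((\<Sum>i\<in>UNIV. \<omega> k $ i) $ j)" for j
      proof -
        have "x k $ i $ j \<le> (\<Sum>i\<in>UNIV. x k $ i $ j)"
          by (rule member_le_sum) (use xX in \<open>auto simp: commodity_space_def less_imp_le\<close>)
        also have "\<dots> = (\<Sum>i\<in>UNIV. \<omega> k $ i) $ j" by (simp flip: market)
        finally show ?thesis
          using xX[of k i] by (simp add: commodity_space_def less_imp_le)
      qed
      then show ?thesis using B[of k] norm_le_componentwise_cart order_trans by blast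
    qed
    then have "(\<Sum>i\<in>UNIV. norm (x k $ i)) \<le> (\<Sum>i\<in>(UNIV::'m set). B)" by (intro sum_mono)
    moreover have "norm (x k) \<le> (\<Sum>i\<in>UNIV. norm (x k $ i))"
      unfolding norm_vec_def by (rule L2_set_le_sum) auto
    ultimately show ?thesis by simp
  qed
  then have bounded_x: "bounded (range x)" unfolding bounded_iff by blast
  have bounded_\<pi>: "bounded (range \<pi>)"
    unfolding bounded_iff using p0 by (intro exI[of _ 1]) (auto simp: \<pi>_def)
  have "bounded (range (\<lambda>k. (\<pi> k, x k)))"
    by (rule bounded_subset[OF bounded_Times[OF bounded_\<pi> bounded_x]]) auto
  then obtain l r where r: "strict_mono r" and l: "((\<lambda>k. (\<pi> k, x k)) \<circ> r) \<longlonglongrightarrow> l"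
    using bounded_imp_convergent_subsequence by blast
  obtain \<rho> z where z: "l = (\<rho>, z)" by fastforce
  have lim_\<pi>: "(\<lambda>k. \<pi> (r k)) \<longlonglongrightarrow> \<rho>" and lim_x: "(\<lambda>k. x (r k)) \<longlonglongrightarrow> z"
    using tendsto_fst[OF l] tendsto_snd[OF l] by (simp_all add: z o_def)
  have lim_\<omega>: "(\<lambda>k. \<omega> (r k)) \<longlonglongrightarrow> \<eta>"
    using LIMSEQ_subseq_LIMSEQ[OF lim r] by (simp add: o_def)
  have \<rho>0: "0 \<le> \<rho> $ j" for j
    by (rule LIMSEQ_le_const[OF tendsto_vec_nth[OF lim_\<pi>]]) (use pos in \<open>auto intro: less_imp_le\<close>)
  have "norm \<rho> = 1"
    by (rule LIMSEQ_unique[OF tendsto_norm[OF lim_\<pi>]]) (use p0 in \<open>simp add: \<pi>_def\<close>)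
  then have "\<rho> \<noteq> 0" by auto
  \<comment> \<open>Half the limiting endowment lies eventually below the actual endowments, so
    every late demand is at least as good as it. The closed upper contour set keeps the limit off
    the boundary of the orthant.\<close>
  have zX: "z $ i \<in> commodity_space" for i
  proof -
    define w where "w = \<eta> $ i /\<^sub>R 2"
    have \<eta>i: "\<And>j. \<eta> $ i $ j > 0" using \<eta> by (auto simp: economies_def commodity_space_def)
    then have w: "w \<in> commodity_space" by (simp add: w_def commodity_space_def)
    have "\<forall>\<^sub>F k in sequentially. \<forall>j. w $ j < \<omega> (r k) $ i $ j"
      by (rule eventually_all_finite, rule order_tendstoD(1)[OF tendsto_vec_nth[OF tendsto_vec_nth[OF lim_\<omega>]]])
         (use \<eta>i in \<open>simp add: w_def\<close>)
    then have "\<forall>\<^sub>F k in sequentially. x (r k) $ i \<in> {y \<in> commodity_space. u i w \<le> u i y}"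
    proof eventually_elim
      case (elim k)
      have "u i w < u i (\<omega> (r k) $ i)"
        by (rule utility_strict_mono[OF u w \<omega>]) (use elim in \<open>auto intro: less_imp_le\<close>)
      also have "\<dots> \<le> u i (x (r k) $ i)" by (rule xm[OF \<omega>]) simp
      finally show ?case using xX by simp
    qed
    then have "z $ i \<in> {y \<in> commodity_space. u i w \<le> u i y}"
      by (rule Lim_in_closed_set[OF closed_upper_contour_set[OF u w] _
            sequentially_bot tendsto_vec_nth[OF lim_x]])
    then show ?thesis by simp
  qed
  have income: "0 < \<rho> \<bullet> \<eta> $ i" for i
  proof -
    obtain j where "\<rho> $ j \<noteq> 0" using \<open>\<rho> \<noteq> 0\<close> by (auto simp: vec_eq_iff)
    then have "0 < \<rho> $ j * \<eta> $ i $ j"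
      using \<rho>0[of j] \<eta> by (intro mult_pos_pos) (auto simp: economies_def commodity_space_def)
    then show ?thesis
      unfolding inner_vec_def inner_real_def using \<rho>0 \<eta>
      by (intro sum_pos2[where i=j]) (auto simp: economies_def commodity_space_def less_imp_le)
  qed
  have u_lim: "(\<lambda>k. u i (x (r k) $ i)) \<longlonglongrightarrow> u i (z $ i)" for i
    using isCont_tendsto_compose[OF utility_isCont[OF u zX] tendsto_vec_nth[OF lim_x]] .
  \<comment> \<open>A bundle strictly inside the limiting budget is eventually affordable along the
    subsequence, so the comparison of utilities passes to the limit.\<close>
  have max_strict: "u i y \<le> u i (z $ i)"
    if y: "y \<in> commodity_space" "\<rho> \<bullet> y < \<rho> \<bullet> \<eta> $ i" for i y
  proof -
    have "(\<lambda>k. \<pi> (r k) \<bullet> \<omega> (r k) $ i - \<pi> (r k) \<bullet> y) \<longlonglongrightarrow> \<rho> \<bullet> \<eta> $ i - \<rho> \<bullet> y"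
      by (intro tendsto_intros lim_\<pi> lim_\<omega>)
    then have "\<forall>\<^sub>F k in sequentially. 0 < \<pi> (r k) \<bullet> \<omega> (r k) $ i - \<pi> (r k) \<bullet> y"
      by (rule order_tendstoD) (use y in simp)
    then have "\<forall>\<^sub>F k in sequentially. u i y \<le> u i (x (r k) $ i)"
    proof eventually_elim
      case (elim k)
      then have "p (r k) \<bullet> y \<le> p (r k) \<bullet> \<omega> (r k) $ i"
        using p0[of "r k"] by (simp add: \<pi>_def zero_less_mult_iff flip: right_diff_distrib)
      then show ?case by (rule xm[OF y(1)])
    qed
    then show ?thesis by (rule tendsto_lowerbound[OF u_lim]) simp
  qed
  have max: "u i y \<le> u i (z $ i)"
    if y: "y \<in> commodity_space" "\<rho> \<bullet> y \<le> \<rho> \<bullet> \<eta> $ i" for i y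
  proof -
    \<comment> \<open>Scaling by \<open>s k\<close> makes a bundle on the budget line strictly
      affordable, because the limiting income is positive. The index is shifted by one so that
      \<open>s 0\<close> is positive.\<close>
    define s where "s k = real (Suc k) / real (Suc (Suc k))" for k
    have s: "0 < s k" "s k < 1" for k by (auto simp: s_def)
    have "s \<longlonglongrightarrow> 1" unfolding s_def by (rule LIMSEQ_Suc[OF LIMSEQ_n_over_Suc_n])
    then have "(\<lambda>k. s k *\<^sub>R y) \<longlonglongrightarrow> y" using tendsto_scaleR[of s 1 _ "\<lambda>_. y" y] by simp
    then have "(\<lambda>k. u i (s k *\<^sub>R y)) \<longlonglongrightarrow> u i y"
      by (rule isCont_tendsto_compose[OF utility_isCont[OF u y(1)]])
    moreover have "u i (s k *\<^sub>R y) \<le> u i (z $ i)" for k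
    proof (rule max_strict)
      show "s k *\<^sub>R y \<in> commodity_space" using y(1) s by (simp add: commodity_space_def)
      have "s k * (\<rho> \<bullet> y) \<le> s k * (\<rho> \<bullet> \<eta> $ i)" using y(2) s(1)[of k] by (intro mult_left_mono) auto
      also have "\<dots> < \<rho> \<bullet> \<eta> $ i" using income[of i] s[of k] by simp
      finally show "\<rho> \<bullet> (s k *\<^sub>R y) < \<rho> \<bullet> \<eta> $ i" by simp
    qed
    ultimately show ?thesis by (intro LIMSEQ_le_const2) auto
  qed
  have budget: "\<rho> \<bullet> z $ i \<le> \<rho> \<bullet> \<eta> $ i" for i
  proof (rule LIMSEQ_le)
    show "(\<lambda>k. \<pi> (r k) \<bullet> x (r k) $ i) \<longlonglongrightarrow> \<rho> \<bullet> z $ i"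
      by (intro tendsto_intros lim_\<pi> lim_x)
    show "(\<lambda>k. \<pi> (r k) \<bullet> \<omega> (r k) $ i) \<longlonglongrightarrow> \<rho> \<bullet> \<eta> $ i"
      by (intro tendsto_intros lim_\<pi> lim_\<omega>)
    show "\<exists>N. \<forall>k\<ge>N. \<pi> (r k) \<bullet> x (r k) $ i \<le> \<pi> (r k) \<bullet> \<omega> (r k) $ i"
      using xb p0 by (auto simp: \<pi>_def intro!: mult_left_mono)
  qed
  have \<rho>_pos: "0 < \<rho> $ j" for j
  proof (rule ccontr)
    assume "\<not> 0 < \<rho> $ j"
    then have "\<rho> $ j = 0" using \<rho>0[of j] by simp
    \<comment> \<open>One more unit of a good with price zero costs nothing yet raises utility; the
      consumer \<open>undefined\<close> is an arbitrary one.\<close>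
    define y where "y = z $ undefined + axis j 1"
    have "y \<in> commodity_space"
      using zX[of undefined] by (auto simp: y_def commodity_space_def axis_def intro: add_pos_nonneg)
    moreover have "\<rho> \<bullet> y \<le> \<rho> \<bullet> \<eta> $ undefined"
      using budget[of undefined] \<open>\<rho> $ j = 0\<close> by (simp add: y_def inner_add_right inner_axis)
    ultimately have "u undefined y \<le> u undefined (z $ undefined)" by (rule max)
    moreover have "u undefined (z $ undefined) < u undefined y"
      by (rule utility_strict_mono[OF u zX \<open>y \<in> commodity_space\<close>])
         (auto simp: y_def axis_def vec_eq_iff)
    ultimately show False by simp
  qed
  define q where "q = \<rho> /\<^sub>R \<rho> $ n"
  have "(\<lambda>k. \<pi> (r k) /\<^sub>R \<pi> (r k) $ n) \<longlonglongrightarrow> q"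
    unfolding q_def using \<rho>_pos[of n] by (intro tendsto_intros lim_\<pi>) auto
  moreover have "\<pi> k /\<^sub>R \<pi> k $ n = p k" for k
    using p0[of k] p(2)[of k] by (simp add: \<pi>_def)
  ultimately have "(p \<circ> r) \<longlonglongrightarrow> q" by (simp add: o_def)
  moreover have "(q, \<eta>) \<in> equilibrium_manifold n u"
  proof -
    have "q \<in> price_space n" using \<rho>_pos by (simp add: price_space_def q_def less_imp_neq[symmetric])
    moreover have "demand (u i) q (\<eta> $ i) = z $ i" for i
    proof (rule demand_eqI[OF u])
      have "q \<bullet> y \<le> q \<bullet> \<eta> $ i \<longleftrightarrow> \<rho> \<bullet> y \<le> \<rho> \<bullet> \<eta> $ i" for y
        using \<rho>_pos[of n] by (simp add: q_def)
      then show "is_arg_max (u i) (\<lambda>x. x \<in> commodity_space \<and> q \<bullet> x \<le> q \<bullet> \<eta> $ i) (z $ i)"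
        using zX budget max by (auto simp: is_arg_max_def not_less)
    qed
    moreover have "(\<Sum>i\<in>UNIV. z $ i) = (\<Sum>i\<in>UNIV. \<eta> $ i)"
    proof (rule LIMSEQ_unique)
      show "(\<lambda>k. \<Sum>i\<in>UNIV. x (r k) $ i) \<longlonglongrightarrow> (\<Sum>i\<in>UNIV. z $ i)"
        by (intro tendsto_intros lim_x)
      show "(\<lambda>k. \<Sum>i\<in>UNIV. x (r k) $ i) \<longlonglongrightarrow> (\<Sum>i\<in>UNIV. \<eta> $ i)"
        unfolding market by (intro tendsto_intros lim_\<omega>)
    qed
    ultimately show ?thesis
      using \<eta> by (simp add: equilibrium_manifold_def excess_demand_def sum_subtractf)
  qed
  ultimately show ?thesis using r by blast
qed

text \<open>This is properness of the projection: economies subconverge by compactness of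
  \<open>K\<close>, and the preceding lemma makes the prices follow along a further
  subsequence.\<close>

lemma compact_equilibria_over:
  fixes u :: "'m::finite \<Rightarrow> real^'l::finite \<Rightarrow> real"
  assumes u: "\<And>i. smooth_utility (u i)" and K: "compact K" "K \<subseteq> economies"
  shows "compact (equilibrium_manifold n u \<inter> snd -` K)"
  unfolding compact_def
proof (intro allI impI)
  fix f :: "nat \<Rightarrow> (real^'l) \<times> (real^'l^'m)"
  assume "\<forall>k. f k \<in> equilibrium_manifold n u \<inter> snd -` K"
  then have f: "f k \<in> equilibrium_manifold n u" "snd (f k) \<in> K" for k by auto
  obtain \<eta> r where \<eta>: "\<eta> \<in> K" "strict_mono r" "(snd \<circ> f \<circ> r) \<longlonglongrightarrow> \<eta>"
    using K(1) f(2) unfolding compact_def by (metis comp_apply)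
  have "\<exists>q r'. strict_mono r' \<and> (fst \<circ> f \<circ> r \<circ> r') \<longlonglongrightarrow> q \<and> (q, \<eta>) \<in> equilibrium_manifold n u"
    by (rule equilibrium_prices_subsequence_limit[where \<omega>="snd \<circ> f \<circ> r"])
       (use u f \<eta> K(2) in auto)
  then obtain q r' where q: "strict_mono r'" "(fst \<circ> f \<circ> r \<circ> r') \<longlonglongrightarrow> q"
    "(q, \<eta>) \<in> equilibrium_manifold n u"
    by blast
  have "(\<lambda>k. (fst (f (r (r' k))), snd (f (r (r' k))))) \<longlonglongrightarrow> (q, \<eta>)"
    using q(2) LIMSEQ_subseq_LIMSEQ[OF \<eta>(3) q(1)] by (intro tendsto_Pair) (simp_all add: o_def)
  then show "\<exists>l\<in>equilibrium_manifold n u \<inter> snd -` K. \<exists>r. strict_mono r \<and> (f \<circ> r) \<longlonglongrightarrow> l"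
    using q \<eta> strict_mono_o by (intro bexI[of _ "(q, \<eta>)"] exI[of _ "r \<circ> r'"]) (auto simp: o_def)
qed

text \<open>Properness supplies a compact total space, and absence of crises supplies local sheets
  at each of its points, as the covering criterion demands.\<close>

lemma covering_space_off_crises:
  fixes u :: "'m::finite \<Rightarrow> real^'l::finite \<Rightarrow> real"
  assumes u: "\<And>i. smooth_utility (u i)" and K: "compact K" "connected K" "K \<subseteq> economies"
    and crises: "K \<inter> snd ` crisis_transitions n u = {}"
    and ne: "equilibrium_manifold n u \<inter> snd -` K \<noteq> {}"
  shows "covering_space (equilibrium_manifold n u \<inter> snd -` K) snd K"
proof (rule compact_local_homeomorphism_imp_covering_space)
  let ?E = "equilibrium_manifold n u"
  show "compact (?E \<inter> snd -` K)" by (rule compact_equilibria_over[OF u K(1,3)])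
  fix e assume e: "e \<in> ?E \<inter> snd -` K"
  then have "e \<in> ?E - crisis_transitions n u" using crises by blast
  then obtain V N s where V: "e \<in> V" "openin (top_of_set ?E) V" "open N" "homeomorphism V N snd s"
    using local_homeomorphism_off_crises by metis
  \<comment> \<open>The sheets found over open sets of economies are cut down to those lying over
    \<open>K\<close>.\<close>
  have "openin (top_of_set (?E \<inter> snd -` K)) (V \<inter> snd -` K)"
    using V(2) by (auto simp: openin_open)
  moreover have "homeomorphism (V \<inter> snd -` K) (N \<inter> K) snd s"
    using V(4) by (rule homeomorphism_of_subsets) (use V(4) in \<open>auto simp: homeomorphism_def\<close>)
  ultimately show "\<exists>V T q. e \<in> V \<and> openin (top_of_set (?E \<inter> snd -` K)) V \<and>
      openin (top_of_set K) T \<and> homeomorphism V T snd q"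
    using V(1,3) e by (intro exI[of _ "V \<inter> snd -` K"] exI[of _ "N \<inter> K"] exI[of _ s]) (auto simp: openin_open)
qed (use K(2) ne in \<open>auto intro!: continuous_intros\<close>)

section \<open>Path lifting and the price gap\<close>

theorem corollary1:
  fixes u :: "'m::finite \<Rightarrow> real ^ 'l::finite \<Rightarrow> real"
    and n :: 'l
    and e_star :: "(real ^ 'l) \<times> (real ^ 'l ^ 'm)"
    and U :: "((real ^ 'l) \<times> (real ^ 'l ^ 'm)) set"
    and p_minus p_plus :: "real ^ 'l"
    and \<omega>_minus \<omega>_plus :: "real ^ 'l ^ 'm"
    and \<gamma> :: "real \<Rightarrow> real ^ 'l ^ 'm"
  assumes "\<And>i. smooth_utility (u i)"
    and "e_star \<in> equilibrium_manifold n u"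
    and "odd (dim (kernel_on (tangent_space (equilibrium_manifold n u) e_star)
                (differential (equilibrium_manifold n u) snd e_star)))"
    and "\<exists>v \<in> tangent_space (equilibrium_manifold n u) e_star.
           second_intrinsic_derivative_iso (equilibrium_manifold n u) economies snd e_star v"
    and "U \<subseteq> equilibrium_manifold n u"
    and "e_star \<in> (top_of_set (equilibrium_manifold n u)) interior_of U"
    and "(p_minus, \<omega>_minus) \<in> U" and "(p_plus, \<omega>_plus) \<in> U"
    and "regular_equilibrium n u (p_minus, \<omega>_minus)"
    and "regular_equilibrium n u (p_plus, \<omega>_plus)"
    and "(p_minus, \<omega>_minus) \<in> equilibrium_manifold n u - crisis_transitions n u"
    and "(p_plus, \<omega>_plus) \<in> equilibrium_manifold n u - crisis_transitions n u"
    and "\<not> path_component (equilibrium_manifold n u - crisis_transitions n u)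
             (p_minus, \<omega>_minus) (p_plus, \<omega>_plus)"
    and "regular_economy n u \<omega>_minus" and "regular_economy n u \<omega>_plus"
    and "path \<gamma>" and "path_image \<gamma> \<subseteq> economies"
    and "pathstart \<gamma> = \<omega>_minus" and "pathfinish \<gamma> = \<omega>_plus"
  shows "path_image \<gamma> \<inter> snd ` crisis_transitions n u \<noteq> {} \<or>
         (\<exists>g. lifting_from n u \<gamma> (p_minus, \<omega>_minus) g \<and>
              (\<forall>h. lifting_from n u \<gamma> (p_minus, \<omega>_minus) h \<longrightarrow> (\<forall>t\<in>{0..1}. h t = g t)) \<and>
              (\<exists>p. pathfinish g = (p, \<omega>_plus) \<and>
                   ereal (norm (p - p_plus)) \<ge> price_gap n u p_plus \<omega>_plus))"
proof (cases "path_image \<gamma> \<inter> snd ` crisis_transitions n u = {}")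
  case crises: True
  let ?E = "equilibrium_manifold n u" and ?e = "(p_minus, \<omega>_minus)"
  let ?C = "?E \<inter> snd -` path_image \<gamma>"
  have eC: "?e \<in> ?C"
    using assms(11,18) pathstart_in_path_image[of \<gamma>] by auto
  \<comment> \<open>The base is the image of the path, which is compact and connected;
    \<open>?e\<close> shows that the total space is nonempty.\<close>
  have cov: "covering_space ?C snd (path_image \<gamma>)"
    using eC by (intro covering_space_off_crises assms compact_path_image connected_path_image crises) auto
  obtain g where g: "path g" "path_image g \<subseteq> ?C" "pathstart g = ?e"
    "\<And>t. t \<in> {0..1} \<Longrightarrow> snd (g t) = \<gamma> t"
    using covering_space_lift_path_strong[OF cov eC assms(16) order_refl] assms(18) by auto
  have lift: "lifting_from n u \<gamma> ?e g"
    using g by (auto simp: lifting_from_def)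
  \<comment> \<open>Any lifting projects into the image of the path and so stays in
    \<open>?C\<close>; two liftings that agree at 0 then agree on the connected interval.\<close>
  have unique: "h t = g t" if h: "lifting_from n u \<gamma> ?e h" and t: "t \<in> {0..1}" for h t
  proof (rule covering_space_lift_unique[where T="{0..1}" and a=0 and ?g1.0=h and ?g2.0=g and f=\<gamma>, OF cov])
    show "h 0 = g 0" using h g(3) by (simp add: lifting_from_def pathstart_def)
    show "h \<in> {0..1} \<rightarrow> ?C" "g \<in> {0..1} \<rightarrow> ?C"
      using h g by (auto simp: lifting_from_def path_image_def)
  qed (use h g t assms(16) in \<open>auto simp: lifting_from_def path_def path_image_def\<close>)
  have snd_end: "snd (pathfinish g) = \<omega>_plus"
    using g(4)[of 1] assms(19) by (simp add: pathfinish_def)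
  then obtain p where p: "pathfinish g = (p, \<omega>_plus)" by (metis prod.collapse)
  \<comment> \<open>A crisis transition on the lift would project to a crisis economy on the
    path.\<close>
  have "path_image g \<subseteq> ?E - crisis_transitions n u"
    using g(2) crises by blast
  with g(1,3) p have "path_component (?E - crisis_transitions n u) ?e (p, \<omega>_plus)"
    unfolding path_component_def by blast
  then have "p \<noteq> p_plus" using assms(13) by blast
  moreover have "(p, \<omega>_plus) \<in> ?E" using g(2) p pathfinish_in_path_image[of g] by auto
  ultimately have "p \<in> equilibrium_prices n u \<omega>_plus - {p_plus}"
    by (simp add: equilibrium_prices_def equilibrium_manifold_def)
  \<comment> \<open>\<open>p\<close> is one of the prices over which the infimum is taken.\<close>
  then have "price_gap n u p_plus \<omega>_plus \<le> ereal (dist p_plus p)"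
    unfolding price_gap_def by (rule INF_lower)
  then have "price_gap n u p_plus \<omega>_plus \<le> ereal (norm (p - p_plus))"
    by (simp add: dist_norm norm_minus_commute)
  with lift unique p show ?thesis by blast
qed simp

end
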